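(* For every integer $n \geq 4$, $$\sigma^{-}(P(n,1)) = \begin{cases} 4 & \text{if } n \text{ is even},\\ 5 & \text{if } n \text{ is odd}.\end{cases}$$
   Context: For $n \geq 3$, $k \geq 1$ with $2k<n$, the generalized Petersen graph $P(n,k)$ has vertex set $\{u_i, v_i : i=0,1,\dots,n-1\}$ and edge set $\{u_iu_{i+1},\ u_iv_i,\ v_iv_{i+k} : i=0,\dots,n-1\}$, subscripts read modulo $n$. For a simple connected graph $G$ of order $N$, the \textbf{rna} number $\sigma^{-}(G)$ is the minimum, over all bijections $f: V(G)\to\{1,2,\dots,N\}$, of the number of edges $uv$ of $G$ such that $f(u)$ and $f(v)$ have different parity. *)

theory Defs
  imports Main
begin

datatype pvertex = U nat | V nat

definition petersen_verts :: "nat \<Rightarrow> pvertex set" where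
  "petersen_verts n = U ` {0..<n} \<union> V ` {0..<n}"

text \<open>Edges are unordered pairs, i.e. two-element sets of vertices, so every edge is counted once.\<close>

definition petersen_edges :: "nat \<Rightarrow> nat \<Rightarrow> pvertex set set" where
  "petersen_edges n k =
     {{U i, U ((i + 1) mod n)} | i. i < n} \<union>
     {{U i, V i} | i. i < n} \<union>
     {{V i, V ((i + k) mod n)} | i. i < n}"

definition parity_cut :: "'a set set \<Rightarrow> ('a \<Rightarrow> nat) \<Rightarrow> 'a set set" where
  "parity_cut E f = {e \<in> E. \<exists>u v. e = {u, v} \<and> even (f u) \<noteq> even (f v)}"

text \<open>The graph has vertex set \<open>X\<close> and edge set \<open>E\<close>. For finite \<open>X\<close> such bijections exist,
  so the least value is attained.\<close>

definition rna_number :: "'a set \<Rightarrow> 'a set set \<Rightarrow> nat" where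
  "rna_number X E =
     (LEAST m. \<exists>f. bij_betw f X {1..card X} \<and> m = card (parity_cut E f))"

lemma card_petersen_verts: "card (petersen_verts n) = 2 * n"
proof -
  have "card (U ` {0..<n}) = n" "card (V ` {0..<n}) = n"
    by (simp_all add: card_image inj_on_def)
  moreover have "U ` {0..<n} \<inter> V ` {0..<n} = {}" by auto
  ultimately show ?thesis
    unfolding petersen_verts_def by (subst card_Un_disjoint) auto
qed

lemma shift_mod_neq:
  fixes i k n :: nat
  assumes "i < n" "1 \<le> k" "k < n"
  shows "i \<noteq> (i + k) mod n"
proof (cases "i + k < n")
  case False
  then have "(i + k) mod n = i + k - n" using assms by (simp add: mod_if)
  then show ?thesis using assms False by linarith
qed (use assms in auto)

lemma petersen_simple:
  assumes "n \<ge> 3" "k \<ge> 1" "2 * k < n" "e \<in> petersen_edges n k"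
  shows "e \<subseteq> petersen_verts n \<and> card e = 2"
  using assms shift_mod_neq[of _ n 1] shift_mod_neq[of _ n k]
  unfolding petersen_edges_def petersen_verts_def
  by (auto simp: card_insert_if)

end

theory Submission
  imports Defs
begin

text \<open>The graph is a prism, and the parity classes split its vertices into two halves of size \<open>n\<close>.
  A rim cycle that is not monochromatic contributes at least two cut edges. If a rim is monochromatic,
  balance forces the other rim to have the opposite colour, so all \<open>n \<ge> 4\<close> spokes are cut. Otherwise
  the rims contribute at least four cut edges, and since the number of cut spokes has the same parity
  as \<open>n\<close>, odd \<open>n\<close> costs one spoke more. Colouring an arc of length \<open>\<lfloor>n/2\<rfloor>\<close> on one rim and the
  aligned arc of length \<open>\<lceil>n/2\<rceil>\<close> on the other attains the bound.\<close>

definition cycle_changes :: "nat \<Rightarrow> (nat \<Rightarrow> bool) \<Rightarrow> nat set" where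
  "cycle_changes n a = {i. i < n \<and> a i \<noteq> a ((i + 1) mod n)}"

lemma finite_cycle_changes [simp]: "finite (cycle_changes n a)"
  by (simp add: cycle_changes_def)

lemma Suc_mod_eq: "i < n \<Longrightarrow> Suc i mod n = (if Suc i = n then 0 else Suc i)"
  by auto

lemma doubleton_in_parity_cut_iff:
  "{x, y} \<in> parity_cut E f \<longleftrightarrow> {x, y} \<in> E \<and> even (f x) \<noteq> even (f y)"
  by (auto simp: parity_cut_def doubleton_eq_iff)

lemma cycle_edge_inj:
  fixes n i j :: nat
  assumes "n \<ge> 3" "i < n" "j < n" "{i, (i + 1) mod n} = {j, (j + 1) mod n}"
  shows "i = j"
  using assms by (auto simp: doubleton_eq_iff Suc_mod_eq split: if_splits)

lemma card_parity_cut_prism: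
  assumes n: "n \<ge> 3"
  shows "card (parity_cut (petersen_edges n 1) f) =
    card (cycle_changes n (\<lambda>i. even (f (U i)))) + card (cycle_changes n (\<lambda>i. even (f (V i)))) +
    card {i. i < n \<and> even (f (U i)) \<noteq> even (f (V i))}"
proof -
  let ?A = "cycle_changes n (\<lambda>i. even (f (U i)))"
  let ?B = "cycle_changes n (\<lambda>i. even (f (V i)))"
  let ?S = "{i. i < n \<and> even (f (U i)) \<noteq> even (f (V i))}"
  let ?u = "\<lambda>i. {U i, U ((i + 1) mod n)}"
  let ?v = "\<lambda>i. {V i, V ((i + 1) mod n)}"
  let ?s = "\<lambda>i. {U i, V i}"
  have cut: "parity_cut (petersen_edges n 1) f = ?u ` ?A \<union> ?v ` ?B \<union> ?s ` ?S"
  proof (intro subset_antisym subsetI)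
    fix e assume e: "e \<in> parity_cut (petersen_edges n 1) f"
    then have "e \<in> petersen_edges n 1" by (simp add: parity_cut_def)
    then obtain i where "i < n" "e = ?u i \<or> e = ?s i \<or> e = ?v i"
      by (auto simp: petersen_edges_def)
    with e show "e \<in> ?u ` ?A \<union> ?v ` ?B \<union> ?s ` ?S"
      by (auto simp only: doubleton_in_parity_cut_iff cycle_changes_def)
  next
    fix e assume "e \<in> ?u ` ?A \<union> ?v ` ?B \<union> ?s ` ?S"
    moreover have "?u i \<in> petersen_edges n 1" "?v i \<in> petersen_edges n 1" "?s i \<in> petersen_edges n 1"
      if "i < n" for i using that unfolding petersen_edges_def by blast+
    ultimately show "e \<in> parity_cut (petersen_edges n 1) f"
      by (elim UnE imageE)
        (simp_all only: doubleton_in_parity_cut_iff cycle_changes_def mem_Collect_eq simp_thms)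
  qed
  have "inj_on ?u ?A"
  proof (rule inj_onI)
    fix i j assume "i \<in> ?A" "j \<in> ?A" "?u i = ?u j"
    then show "i = j"
      by (intro cycle_edge_inj[OF n]) (auto simp: cycle_changes_def doubleton_eq_iff)
  qed
  moreover have "inj_on ?v ?B"
  proof (rule inj_onI)
    fix i j assume "i \<in> ?B" "j \<in> ?B" "?v i = ?v j"
    then show "i = j"
      by (intro cycle_edge_inj[OF n]) (auto simp: cycle_changes_def doubleton_eq_iff)
  qed
  moreover have "inj_on ?s ?S"
    by (auto simp: inj_on_def doubleton_eq_iff)
  moreover have "?u ` ?A \<inter> ?v ` ?B = {}" "(?u ` ?A \<union> ?v ` ?B) \<inter> ?s ` ?S = {}"
    by (auto simp: doubleton_eq_iff)
  ultimately show ?thesis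
    unfolding cut by (simp add: card_Un_disjoint card_image)
qed

lemma card_cycle_changes_ge_2:
  assumes ij: "i < n" "j < n" "a i \<noteq> a j"
  shows "card (cycle_changes n a) \<ge> 2"
proof (rule ccontr)
  assume "\<not> ?thesis"
  then have "card (cycle_changes n a) \<le> Suc 0" by simp
  then obtain c where c: "c < n" "cycle_changes n a \<subseteq> {c}"
  proof (cases "cycle_changes n a = {}")
    case True
    then show ?thesis using that[of i] ij by simp
  next
    case False
    then obtain d where "d \<in> cycle_changes n a" by blast
    moreover from this have "cycle_changes n a \<subseteq> {d}"
      using \<open>card (cycle_changes n a) \<le> Suc 0\<close> by (auto simp: card_le_Suc0_iff_eq)
    ultimately show ?thesis using that[of d] by (simp add: cycle_changes_def)
  qed
  have walk: "a ((c + 1 + t) mod n) = a ((c + 1) mod n)" if "t < n" for t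
    using that
  proof (induction t)
    case (Suc t)
    let ?k = "(c + 1 + t) mod n"
    have "?k \<noteq> c"
      using shift_mod_neq[of c n "t + 1"] c(1) Suc.prems by (simp add: add_ac)
    moreover have "?k < n" using c(1) by simp
    ultimately have "a ?k = a ((?k + 1) mod n)"
      using c(2) by (auto simp: cycle_changes_def)
    then show ?case using Suc by (simp add: mod_simps)
  qed simp
  have "a k = a ((c + 1) mod n)" if "k < n" for k
  proof (cases "k \<le> c")
    case True
    then show ?thesis using walk[of "n + k - (c + 1)"] c(1) that by simp
  next
    case False
    then show ?thesis using walk[of "k - (c + 1)"] that by simp
  qed
  then show False using ij by blast
qed

lemma card_cycle_changes_arc:
  assumes "0 < m" "m < n"
  shows "card (cycle_changes n (\<lambda>i. i < m)) = 2"
proof -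
  have "cycle_changes n (\<lambda>i. i < m) = {m - 1, n - 1}"
    using assms by (auto simp: cycle_changes_def Suc_mod_eq split: if_splits)
  then show ?thesis using assms by simp
qed

lemma card_Collect_xor:
  fixes a b :: "nat \<Rightarrow> bool"
  shows "card {i. i < n \<and> a i} + card {i. i < n \<and> b i} =
    card {i. i < n \<and> a i \<noteq> b i} + 2 * card {i. i < n \<and> a i \<and> b i}"
proof -
  have "card {i. i < n \<and> a i} + card {i. i < n \<and> b i} =
    card ({i. i < n \<and> a i} \<union> {i. i < n \<and> b i}) + card ({i. i < n \<and> a i} \<inter> {i. i < n \<and> b i})"
    by (rule card_Un_Int) auto
  also have "{i. i < n \<and> a i} \<union> {i. i < n \<and> b i} =
    {i. i < n \<and> a i \<noteq> b i} \<union> {i. i < n \<and> a i \<and> b i}" by auto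
  also have "card \<dots> = card {i. i < n \<and> a i \<noteq> b i} + card {i. i < n \<and> a i \<and> b i}"
    by (rule card_Un_disjoint) auto
  also have "{i. i < n \<and> a i} \<inter> {i. i < n \<and> b i} = {i. i < n \<and> a i \<and> b i}" by auto
  finally show ?thesis by simp
qed

lemma balanced_prism_cut_ge:
  fixes a b :: "nat \<Rightarrow> bool"
  assumes n: "n \<ge> 4"
    and bal: "card {i. i < n \<and> a i} + card {i. i < n \<and> b i} = n"
  shows "(if even n then 4 else 5) \<le>
    card (cycle_changes n a) + card (cycle_changes n b) + card {i. i < n \<and> a i \<noteq> b i}"
proof -
  let ?S = "{i. i < n \<and> a i \<noteq> b i}"
  have par: "even (card ?S) \<longleftrightarrow> even n"
    using card_Collect_xor[of n a b] bal by presburger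
  have mono: "card ?S = n"
    if const: "\<forall>i<n. p i = c" and pq: "card {i. i < n \<and> p i} + card {i. i < n \<and> q i} = n"
      and S: "?S = {i. i < n \<and> p i \<noteq> q i}"
    for p q :: "nat \<Rightarrow> bool" and c
  proof -
    have "\<forall>i<n. q i = (\<not> c)"
    proof (cases c)
      case True
      then have "{i. i < n \<and> p i} = {..<n}" using const by auto
      then have "{i. i < n \<and> q i} = {}" using pq by auto
      then show ?thesis using True by auto
    next
      case False
      then have "{i. i < n \<and> p i} = {}" using const by auto
      then have "card {i. i < n \<and> q i} = card {..<n}" using pq by (metis add_0 card.empty card_lessThan)
      moreover have "{i. i < n \<and> q i} \<subseteq> {..<n}" by auto
      ultimately have "{i. i < n \<and> q i} = {..<n}" by (intro card_subset_eq) auto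
      then show ?thesis using False by auto
    qed
    then have "?S = {..<n}" using const S by auto
    then show ?thesis by simp
  qed
  show ?thesis
  proof (cases "(\<exists>i<n. \<exists>j<n. a i \<noteq> a j) \<and> (\<exists>i<n. \<exists>j<n. b i \<noteq> b j)")
    case True
    then have "card (cycle_changes n a) \<ge> 2" "card (cycle_changes n b) \<ge> 2"
      by (metis card_cycle_changes_ge_2)+
    moreover have "(if even n then 0 else 1) \<le> card ?S" using par by presburger
    ultimately show ?thesis by presburger
  next
    case False
    moreover have "0 < n" using n by simp
    ultimately consider "\<forall>i<n. a i = a 0" | "\<forall>i<n. b i = b 0" by blast
    then have "card ?S = n"
    proof cases
      case 1
      show ?thesis by (rule mono[OF 1 bal]) simp
    next
      case 2
      show ?thesis by (rule mono[OF 2, of a]) (use bal in auto)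
    qed
    moreover have "n \<noteq> 4" if "odd n" using that by auto
    ultimately show ?thesis using n by auto
  qed
qed

lemma card_even_atLeastAtMost: "card {k \<in> {1..2 * n}. even k} = n"
proof -
  have "{k \<in> {1..2 * n}. even k} = (\<lambda>i. 2 * i) ` {1..n}"
    by (auto elim!: evenE)
  then show ?thesis by (simp add: card_image inj_on_def)
qed

lemma card_even_labels:
  assumes f: "bij_betw f (petersen_verts n) {1..card (petersen_verts n)}"
  shows "card {i. i < n \<and> even (f (U i))} + card {i. i < n \<and> even (f (V i))} = n"
proof -
  let ?A = "{i. i < n \<and> even (f (U i))}" and ?B = "{i. i < n \<and> even (f (V i))}"
  let ?T = "{x \<in> petersen_verts n. even (f x)}"
  have "f ` petersen_verts n = {1..2 * n}"
    using f by (simp add: bij_betw_def card_petersen_verts)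
  moreover have "f ` ?T = {k \<in> f ` petersen_verts n. even k}" by blast
  ultimately have "f ` ?T = {k \<in> {1..2 * n}. even k}" by simp
  moreover have "inj_on f ?T"
    using bij_betw_imp_inj_on[OF f] by (rule inj_on_subset) blast
  ultimately have "card ?T = n"
    using card_image[of f ?T] card_even_atLeastAtMost[of n] by simp
  moreover have "?T = U ` ?A \<union> V ` ?B" by (auto simp: petersen_verts_def)
  moreover have "card (U ` ?A \<union> V ` ?B) = card ?A + card ?B"
    by (subst card_Un_disjoint) (auto simp: card_image inj_on_def)
  ultimately show ?thesis by simp
qed

lemma balanced_parity_labelling_exists:
  assumes "finite X" "T \<subseteq> X" "card X = 2 * n" "card T = n"
  shows "\<exists>f. bij_betw f X {1..card X} \<and> (\<forall>x\<in>X. even (f x) \<longleftrightarrow> x \<in> T)"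
proof -
  let ?E = "{k \<in> {1..2 * n}. even k}" and ?O = "{k \<in> {1..2 * n}. odd k}"
  have split: "?E \<union> ?O = {1..2 * n}" "?E \<inter> ?O = {}" by auto
  then have "card ?E + card ?O = 2 * n"
    by (metis (no_types, lifting) card_Un_disjoint card_atLeastAtMost diff_Suc_1 finite_Un
        finite_atLeastAtMost plus_1_eq_Suc add.commute)
  then have "card ?O = n" using card_even_atLeastAtMost[of n] by simp
  moreover have "card (X - T) = n" using assms by (simp add: card_Diff_subset finite_subset)
  ultimately obtain h where h: "bij_betw h (X - T) ?O"
    using finite_same_card_bij[of "X - T" ?O] assms by auto
  obtain g where g: "bij_betw g T ?E"
    using finite_same_card_bij[of T ?E] assms card_even_atLeastAtMost[of n]
      finite_subset[OF assms(2,1)] by auto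
  let ?f = "\<lambda>x. if x \<in> T then g x else h x"
  have gT: "bij_betw ?f T ?E" using g by (simp cong: bij_betw_cong)
  have hT: "bij_betw ?f (X - T) ?O" using h by (rule bij_betw_cong[THEN iffD1, rotated]) simp
  have "bij_betw ?f (T \<union> (X - T)) (?E \<union> ?O)"
    using gT hT split(2) by (rule bij_betw_combine)
  moreover have "T \<union> (X - T) = X" using assms by auto
  ultimately have "bij_betw ?f X {1..card X}" using split assms by simp
  moreover have "even (?f x) \<longleftrightarrow> x \<in> T" if "x \<in> X" for x
    using bij_betwE[OF gT] bij_betwE[OF hT] that by (cases "x \<in> T") blast+
  ultimately show ?thesis by blast
qed

lemma prism_cut_attained:
  assumes n: "n \<ge> 4"
  shows "\<exists>f. bij_betw f (petersen_verts n) {1..card (petersen_verts n)} \<and>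
    (if even n then 4 else 5) = card (parity_cut (petersen_edges n 1) f)"
proof -
  define m where "m = n div 2"
  define m' where "m' = n - n div 2"
  define T where "T = U ` {..<m} \<union> V ` {..<m'}"
  have m: "0 < m" "m < n" "0 < m'" "m' < n" "m + m' = n"
    using n by (auto simp: m_def m'_def)
  have "card T = n"
    unfolding T_def using m by (subst card_Un_disjoint) (auto simp: card_image inj_on_def)
  moreover have "T \<subseteq> petersen_verts n" using m by (auto simp: T_def petersen_verts_def)
  moreover have "finite (petersen_verts n)" by (simp add: petersen_verts_def)
  ultimately obtain f where f: "bij_betw f (petersen_verts n) {1..card (petersen_verts n)}"
    and fT: "\<forall>x\<in>petersen_verts n. even (f x) \<longleftrightarrow> x \<in> T"
    using balanced_parity_labelling_exists card_petersen_verts by metis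
  have u: "even (f (U i)) \<longleftrightarrow> i < m" and v: "even (f (V i)) \<longleftrightarrow> i < m'" if "i < n" for i
    using fT that by (auto simp: petersen_verts_def T_def)
  have "cycle_changes n (\<lambda>i. even (f (U i))) = cycle_changes n (\<lambda>i. i < m)"
    "cycle_changes n (\<lambda>i. even (f (V i))) = cycle_changes n (\<lambda>i. i < m')"
    using n by (auto simp: cycle_changes_def u v)
  moreover have "{i. i < n \<and> even (f (U i)) \<noteq> even (f (V i))} = {m..<m'}"
    using m by (auto simp: u v m_def m'_def)
  moreover have "m' - m = (if even n then 0 else 1)"
    by (auto simp: m_def m'_def elim!: evenE oddE)
  ultimately have "card (parity_cut (petersen_edges n 1) f) = (if even n then 4 else 5)"
    using card_parity_cut_prism[of n f] card_cycle_changes_arc[OF m(1,2)]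
      card_cycle_changes_arc[OF m(3,4)] n by (simp split: if_splits)
  with f show ?thesis by metis
qed

theorem theorem4p7:
  fixes n :: nat
  assumes "n \<ge> 4"
  shows "rna_number (petersen_verts n) (petersen_edges n 1) = (if even n then 4 else 5)"
  unfolding rna_number_def
proof (rule Least_equality)
  show "\<exists>f. bij_betw f (petersen_verts n) {1..card (petersen_verts n)} \<and>
    (if even n then 4 else 5) = card (parity_cut (petersen_edges n 1) f)"
    using assms by (rule prism_cut_attained)
next
  fix k
  assume "\<exists>f. bij_betw f (petersen_verts n) {1..card (petersen_verts n)} \<and>
    k = card (parity_cut (petersen_edges n 1) f)"
  then obtain f where f: "bij_betw f (petersen_verts n) {1..card (petersen_verts n)}"
    and k: "k = card (parity_cut (petersen_edges n 1) f)" by blast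
  show "(if even n then 4 else 5) \<le> k"
    using balanced_prism_cut_ge[OF assms card_even_labels[OF f]] assms
    unfolding k by (simp only: card_parity_cut_prism)
qed

end
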